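(* Let the mesh, edge quadrature, invariant domain $G$, cell average decomposition, weak Lax–Friedrichs splitting and conservative forward Euler update with Lax–Friedrichs flux be as in the context. For every $K\in\mathcal T_h$ let $\hat u_K^n=\Pi_K(u_K^n;\bar u_K^n)$ be a $G$-admissible reconstruction. Then there exists an explicit CFL condition of the form $$\Delta t\le\min_{K\in\mathcal T_h}\frac{\mu_K}{2\,\alpha_K^n},\qquad\alpha_K^n:=\max_{e\in\mathcal E_K}\max_{\nu=1,\dots,N_q}\tilde\alpha\bigl(\hat u_{K,e,\nu}^n,\,n_{K,e}\bigr),$$ such that, under this condition, the updated cell averages satisfy $\bar u_K^{n+1}\in G$ for all $K\in\mathcal T_h$. In particular, if each boundary edge $e\subset\partial\Omega$ is assigned an exterior state satisfying $\hat u_{K_e,e,\nu}^n\in G$, then the averages of boundary cells also satisfy $\bar u_K^{n+1}\in G$ under the same CFL condition.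
   Context: PDE: $\partial_tu+\nabla\cdot F(u)=0$, $F=(f_1,f_2)$, $u\in\mathbb R^m$, $F(u)\cdot n:=\sum_in_if_i(u)$. Mesh: $\mathcal T_h$ is a conforming, uniformly shape-regular partition of $\Omega\subseteq\mathbb R^2$ into open convex polygonal cells $K$ with uniformly bounded number of edges; $|K|$ area, $\mathcal E_K$ edges, $|e|$ length, $n_{K,e}$ outward unit normal, $K_e$ the neighbour across $e$ (on boundary edges $K_e$ stands for a boundary state). $\mathbb W_K\supseteq(\mathbb P^k(K))^m$ is a finite-dimensional space of $\mathbb R^m$-valued functions on $K$, and $u_K^n\in\mathbb W_K$ is a reconstruction with $\frac1{|K|}\int_Ku_K^n\,dx=\bar u_K^n$. On each edge a quadrature rule with nodes $x_{e,\nu}\in e$, weights $\omega_{e,\nu}>0$, $\sum_{\nu=1}^{N_q}\omega_{e,\nu}=1$, computes the edge average $\frac1{|e|}\int_e\varphi\,ds$ exactly for all $\varphi\in\mathbb W_K$. Invariant domain: $\mathcal J$ finite; $G=\{u\in\mathbb R^m:g_j(u)\ge0\ \forall j\in\mathcal J\}$ is convex and is the closure of $\{u:g_j(u)>0\ \forall j\}$; each $g_j$ is concave and $C^1$ on an open set containing $G$. $S_j=\partial G\cap\partial\{g_j\ge0\}$; for $u_j^*\in S_j$, $n_j^*:=\nabla g_j(u_j^* )\neq0$. Then $G=\{u:(u-u_j^* )\cdot n_j^*\ge0\ \forall u_j^*\in S_j,\forall j\in\mathcal J\}$. Cell average decomposition (CAD): with $\mathbb V_K\in\{(\mathbb P^k(K))^m,\mathbb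 W_K\}$, there are $\lambda_{K,e}>0$, $\beta_{K,s}>0$, $\sum_{e}\lambda_{K,e}+\sum_s\beta_{K,s}=1$, and $x_{K,s}^*\in\overline K$ such that $\frac1{|K|}\int_K\phi\,dx=\sum_{e}\lambda_{K,e}\frac1{|e|}\int_e\phi\,ds+\sum_{s=1}^{S_K}\beta_{K,s}\phi(x^*_{K,s})$ for all $\phi\in\mathbb V_K$. Set $\mu_K:=\min_{e\in\mathcal E_K}\lambda_{K,e}|K|/|e|$. Limiter: $\Pi_K(u_K;\bar u_K)=\bar u_K+\theta_K(u_K-\bar u_K)$, where either (classic limiter, CAD on $\mathbb V_K=\mathbb W_K$) $\theta_K$ is the supremum of $\theta\in[0,1]$ with $\bar u_K+\theta(u_K(x)-\bar u_K)\in G$ for all $x\in\{x_{e,\nu}\}\cup\{x^*_{K,s}\}$, or (alternative limiter, CAD on $\mathbb V_K=(\mathbb P^k(K))^m$) $\theta_K$ is the supremum of $\theta\in[0,1]$ with $\bar u_K+\theta(u_K(x_{e,\nu})-\bar u_K)\in G$ for all $e,\nu$ and, if $\sum_e\lambda_{K,e}<1$, also $\bar u_K+\theta(u_K^*-\bar u_K)\in G$, with $u_K^*=\bigl(\bar u_K-\sum_e\lambda_{K,e}\frac1{|e|}\int_eu_K\,ds\bigr)/\bigl(1-\sum_e\lambda_{K,e}\bigr)$. $G$-admissibility of $\hat u_K^n\in\mathbb W_K$: $\hat u_K^n(x_{e,\nu})\in G$ for all $e\in\mathcal E_K$ and $\nu$ and, when $\sum_e\lambda_{K,e}<1$, also $\bigl(\bar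 u_K^n-\sum_e\lambda_{K,e}\sum_\nu\omega_{e,\nu}\hat u_K^n(x_{e,\nu})\bigr)/\bigl(1-\sum_e\lambda_{K,e}\bigr)\in G$. Weak Lax–Friedrichs splitting: for every $u\in G$ and unit vector $n$ there is a wave-speed bound $\tilde\alpha(u,n)\ge0$, and for every $j\in\mathcal J$, $u_j^*\in S_j$ a vector $\zeta(u_j^* )\in\mathbb R^2$, such that for every unit $n$: $\alpha(u-u_j^* )\cdot n_j^*\pm(F(u)\cdot n)\cdot n_j^*\ge\mp\zeta(u_j^* )\cdot n$ for all $\alpha\ge\tilde\alpha(u,n)$. Update: with $\hat u_{K,e,\nu}^n=\hat u_K^n(x_{e,\nu})$, $\hat u_{K_e,e,\nu}^n=\hat u_{K_e}^n(x_{e,\nu})$, $$\bar u_K^{n+1}=\bar u_K^n-\frac{\Delta t}{|K|}\sum_{e\in\mathcal E_K}|e|\sum_{\nu}\omega_{e,\nu}\Bigl(\tfrac12\bigl[F(\hat u_{K,e,\nu}^n)+F(\hat u_{K_e,e,\nu}^n)\bigr]\cdot n_{K,e}-\tfrac{\alpha_{K,e,\nu}}{2}\bigl(\hat u_{K_e,e,\nu}^n-\hat u_{K,e,\nu}^n\bigr)\Bigr),$$ where the numerical viscosities satisfy $\alpha_{K,e,\nu}\ge\max\{\tilde\alpha(\hat u_{K,e,\nu}^n,n_{K,e}),\tilde\alpha(\hat u_{K_e,e,\nu}^n,n_{K,e})\}$.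
   Formalization: Two conditions are added, since the claim fails without them: Δt·α_{K,e,ν} ≤ (3/2)μ_K for all numerical viscosities; and, for the alternative limiter with Σ_e λ_{K,e} = 1, the identity ū_K = Σ_e λ_{K,e}(1/|e|)∫_e u_K ds. *)

theory Defs
  imports "HOL-Analysis.Analysis"
begin

type_synonym pt = "real ^ 2"
type_synonym cell = "pt set"
type_synonym edge = "pt set"

section \<open>Mesh\<close>

definition edges :: "cell \<Rightarrow> edge set" where
  "edges K = {e. e edge_of closure K}"

text \<open>The flag that an edge lies on the boundary of \<open>\<Omega>\<close> is purely geometric, so both sides of a
  slit in \<open>\<Omega>\<close> count as boundary.\<close>

definition boundary_edge :: "pt set \<Rightarrow> edge \<Rightarrow> bool" where
  "boundary_edge \<Omega> e \<longleftrightarrow> e \<subseteq> frontier \<Omega>"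

definition is_neighbour :: "cell set \<Rightarrow> cell \<Rightarrow> edge \<Rightarrow> cell \<Rightarrow> bool" where
  "is_neighbour T K e K' \<longleftrightarrow> K' \<in> T \<and> K' \<noteq> K \<and> e \<in> edges K'"

definition neighbour :: "cell set \<Rightarrow> cell \<Rightarrow> edge \<Rightarrow> cell" where
  "neighbour T K e = (THE K'. is_neighbour T K e K')"

definition conforming_mesh :: "pt set \<Rightarrow> cell set \<Rightarrow> bool" where
  "conforming_mesh \<Omega> T \<longleftrightarrow>
     finite T \<and>
     (\<forall>K\<in>T. open K \<and> convex K \<and> K \<noteq> {} \<and> polytope (closure K)) \<and>
     pairwise disjnt T \<and> \<Union>T \<subseteq> \<Omega> \<and> \<Omega> \<subseteq> (\<Union>K\<in>T. closure K) \<and>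
     (\<forall>K\<in>T. \<forall>K'\<in>T. K \<noteq> K' \<longrightarrow> (closure K \<inter> closure K') face_of closure K) \<and>
     (\<forall>K\<in>T. \<forall>e\<in>edges K. boundary_edge \<Omega> e \<or> (\<exists>!K'. is_neighbour T K e K'))"

definition shape_regular :: "real \<Rightarrow> cell set \<Rightarrow> bool" where
  "shape_regular \<sigma> T \<longleftrightarrow> (\<forall>K\<in>T. \<exists>c r. 0 < r \<and> ball c r \<subseteq> K \<and> diameter K \<le> \<sigma> * r)"

definition area :: "cell \<Rightarrow> real" where
  "area K = measure lebesgue K"

text \<open>An edge is a line segment, so its diameter is its length.\<close>

definition edge_length :: "edge \<Rightarrow> real" where
  "edge_length e = diameter e"

definition outward_normal :: "cell \<Rightarrow> edge \<Rightarrow> pt" where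
  "outward_normal K e =
     (THE n. norm n = 1 \<and> (\<exists>c. (\<forall>x\<in>e. n \<bullet> x = c) \<and> (\<forall>x\<in>K. n \<bullet> x \<le> c)))"

section \<open>Averages, function spaces and quadrature\<close>

definition cell_avg :: "cell \<Rightarrow> (pt \<Rightarrow> real ^ 'm) \<Rightarrow> real ^ 'm" where
  "cell_avg K \<phi> = (1 / area K) *\<^sub>R integral K \<phi>"

text \<open>The average over a segment with respect to arc length is the integral of the affine
  parametrisation over \<open>[0, 1]\<close>; it does not depend on the order of the end points.\<close>

definition edge_avg :: "edge \<Rightarrow> (pt \<Rightarrow> real ^ 'm) \<Rightarrow> real ^ 'm" where
  "edge_avg e \<phi> =
     (let (a, b) = (SOME (a, b). e = closed_segment a b) in integral {0..1} (\<lambda>t. \<phi> (linepath a b t)))"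

text \<open>Functions on a cell are modelled by total functions on the plane; only their values on the
  closure of the cell are ever used.\<close>

definition poly_space :: "nat \<Rightarrow> (pt \<Rightarrow> real ^ 'm) set" where
  "poly_space k =
     {p. \<exists>c. p = (\<lambda>x. \<Sum>(i, j)\<in>{(i, j). i + j \<le> k}. ((x $ 1) ^ i * (x $ 2) ^ j) *\<^sub>R c i j)}"

definition finite_dim_space :: "(pt \<Rightarrow> real ^ 'm) set \<Rightarrow> bool" where
  "finite_dim_space W \<longleftrightarrow> (\<exists>B. finite B \<and> W = {w. \<exists>c. w = (\<lambda>x. \<Sum>b\<in>B. c b *\<^sub>R b x)})"

definition edge_quadrature ::
  "nat \<Rightarrow> (edge \<Rightarrow> nat \<Rightarrow> pt) \<Rightarrow> (edge \<Rightarrow> nat \<Rightarrow> real) \<Rightarrow> (pt \<Rightarrow> real ^ 'm) set \<Rightarrow> edge \<Rightarrow> bool" where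
  "edge_quadrature Nq x \<omega> W e \<longleftrightarrow>
     (\<forall>\<nu>\<in>{1..Nq}. x e \<nu> \<in> e \<and> 0 < \<omega> e \<nu>) \<and> (\<Sum>\<nu>=1..Nq. \<omega> e \<nu>) = 1 \<and>
     (\<forall>\<phi>\<in>W. edge_avg e \<phi> = (\<Sum>\<nu>=1..Nq. \<omega> e \<nu> *\<^sub>R \<phi> (x e \<nu>)))"

section \<open>Cell average decomposition\<close>

definition cell_avg_decomp ::
  "cell \<Rightarrow> (pt \<Rightarrow> real ^ 'm) set \<Rightarrow> (edge \<Rightarrow> real) \<Rightarrow> nat \<Rightarrow> (nat \<Rightarrow> real) \<Rightarrow> (nat \<Rightarrow> pt) \<Rightarrow> bool" where
  "cell_avg_decomp K V \<Lambda> S \<beta> xs \<longleftrightarrow>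
     (\<forall>e\<in>edges K. 0 < \<Lambda> e) \<and> (\<forall>s\<in>{1..S}. 0 < \<beta> s \<and> xs s \<in> closure K) \<and>
     (\<Sum>e\<in>edges K. \<Lambda> e) + (\<Sum>s=1..S. \<beta> s) = 1 \<and>
     (\<forall>\<phi>\<in>V. cell_avg K \<phi> = (\<Sum>e\<in>edges K. \<Lambda> e *\<^sub>R edge_avg e \<phi>) + (\<Sum>s=1..S. \<beta> s *\<^sub>R \<phi> (xs s)))"

definition mu :: "cell \<Rightarrow> (edge \<Rightarrow> real) \<Rightarrow> real" where
  "mu K \<Lambda> = (MIN e\<in>edges K. \<Lambda> e * area K / edge_length e)"

section \<open>Invariant domain\<close>

definition inv_dom :: "'j set \<Rightarrow> ('j \<Rightarrow> real ^ 'm \<Rightarrow> real) \<Rightarrow> (real ^ 'm) set" where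
  "inv_dom J g = {u. \<forall>j\<in>J. 0 \<le> g j u}"

definition grad :: "(real ^ 'm \<Rightarrow> real) \<Rightarrow> real ^ 'm \<Rightarrow> real ^ 'm" where
  "grad f u = (THE d. GDERIV f u :> d)"

definition C1_on :: "(real ^ 'm) set \<Rightarrow> (real ^ 'm \<Rightarrow> real) \<Rightarrow> bool" where
  "C1_on U f \<longleftrightarrow> (\<forall>u\<in>U. GDERIV f u :> grad f u) \<and> continuous_on U (grad f)"

definition bdry_part :: "'j set \<Rightarrow> ('j \<Rightarrow> real ^ 'm \<Rightarrow> real) \<Rightarrow> 'j \<Rightarrow> (real ^ 'm) set" where
  "bdry_part J g j = frontier (inv_dom J g) \<inter> frontier {u. 0 \<le> g j u}"

definition invariant_domain :: "'j set \<Rightarrow> ('j \<Rightarrow> real ^ 'm \<Rightarrow> real) \<Rightarrow> bool" where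
  "invariant_domain J g \<longleftrightarrow>
     finite J \<and> convex (inv_dom J g) \<and>
     inv_dom J g = closure {u. \<forall>j\<in>J. 0 < g j u} \<and>
     (\<forall>j\<in>J. \<exists>U. open U \<and> inv_dom J g \<subseteq> U \<and> concave_on U (g j) \<and> C1_on U (g j)) \<and>
     (\<forall>j\<in>J. \<forall>u\<in>bdry_part J g j. grad (g j) u \<noteq> 0)"

section \<open>Limiters and admissibility\<close>

text \<open>The value \<open>u*\<close> with \<open>ubar = (\<Sum>e. \<Lambda> e a\<^sub>e) + (1 - (\<Sum>e. \<Lambda> e)) u*\<close>, where \<open>a\<^sub>e\<close> stands for an edge
  average; used only if the \<open>\<Lambda> e\<close> sum up to less than 1.\<close>

definition interior_value ::
  "cell \<Rightarrow> (edge \<Rightarrow> real) \<Rightarrow> real ^ 'm \<Rightarrow> (edge \<Rightarrow> real ^ 'm) \<Rightarrow> real ^ 'm" where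
  "interior_value K \<Lambda> ubar a =
     (1 / (1 - (\<Sum>e\<in>edges K. \<Lambda> e))) *\<^sub>R (ubar - (\<Sum>e\<in>edges K. \<Lambda> e *\<^sub>R a e))"

definition theta_classic ::
  "(real ^ 'm) set \<Rightarrow> nat \<Rightarrow> (edge \<Rightarrow> nat \<Rightarrow> pt) \<Rightarrow> cell \<Rightarrow> nat \<Rightarrow> (nat \<Rightarrow> pt) \<Rightarrow>
   real ^ 'm \<Rightarrow> (pt \<Rightarrow> real ^ 'm) \<Rightarrow> real" where
  "theta_classic G Nq x K S xs ubar u =
     Sup {\<theta>\<in>{0..1}. \<forall>y \<in> {x e \<nu> | e \<nu>. e \<in> edges K \<and> \<nu> \<in> {1..Nq}} \<union> xs ` {1..S}.
            ubar + \<theta> *\<^sub>R (u y - ubar) \<in> G}"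

text \<open>If the \<open>\<Lambda> e\<close> sum up to 1 the value \<open>u*\<close> is absent. With a decomposition that is exact on
  polynomials only, \<open>ubar = (\<Sum>e. \<Lambda> e a\<^sub>e)\<close> may then fail for a non-polynomial \<open>u\<close> (for instance with a
  bubble function whose traces vanish), so it has to be required separately.\<close>

definition theta_alternative ::
  "(real ^ 'm) set \<Rightarrow> nat \<Rightarrow> (edge \<Rightarrow> nat \<Rightarrow> pt) \<Rightarrow> cell \<Rightarrow> (edge \<Rightarrow> real) \<Rightarrow>
   real ^ 'm \<Rightarrow> (pt \<Rightarrow> real ^ 'm) \<Rightarrow> real" where
  "theta_alternative G Nq x K \<Lambda> ubar u =
     Sup {\<theta>\<in>{0..1}.
            (\<forall>e\<in>edges K. \<forall>\<nu>\<in>{1..Nq}. ubar + \<theta> *\<^sub>R (u (x e \<nu>) - ubar) \<in> G) \<and>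
            ((\<Sum>e\<in>edges K. \<Lambda> e) < 1 \<longrightarrow>
               ubar + \<theta> *\<^sub>R (interior_value K \<Lambda> ubar (\<lambda>e. edge_avg e u) - ubar) \<in> G)}"

definition limit :: "real \<Rightarrow> real ^ 'm \<Rightarrow> (pt \<Rightarrow> real ^ 'm) \<Rightarrow> pt \<Rightarrow> real ^ 'm" where
  "limit \<theta> ubar u = (\<lambda>y. ubar + \<theta> *\<^sub>R (u y - ubar))"

definition admissible ::
  "(real ^ 'm) set \<Rightarrow> nat \<Rightarrow> (edge \<Rightarrow> nat \<Rightarrow> pt) \<Rightarrow> (edge \<Rightarrow> nat \<Rightarrow> real) \<Rightarrow> cell \<Rightarrow> (edge \<Rightarrow> real) \<Rightarrow>
   real ^ 'm \<Rightarrow> (pt \<Rightarrow> real ^ 'm) \<Rightarrow> bool" where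
  "admissible G Nq x \<omega> K \<Lambda> ubar uh \<longleftrightarrow>
     (\<forall>e\<in>edges K. \<forall>\<nu>\<in>{1..Nq}. uh (x e \<nu>) \<in> G) \<and>
     ((\<Sum>e\<in>edges K. \<Lambda> e) < 1 \<longrightarrow>
        interior_value K \<Lambda> ubar (\<lambda>e. \<Sum>\<nu>=1..Nq. \<omega> e \<nu> *\<^sub>R uh (x e \<nu>)) \<in> G)"

section \<open>Flux, weak Lax--Friedrichs splitting and the scheme\<close>

definition normal_flux :: "(real ^ 'm \<Rightarrow> (real ^ 'm) ^ 2) \<Rightarrow> real ^ 'm \<Rightarrow> pt \<Rightarrow> real ^ 'm" where
  "normal_flux F u n = (\<Sum>i\<in>UNIV. (n $ i) *\<^sub>R (F u $ i))"

definition weak_LF_splitting ::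
  "'j set \<Rightarrow> ('j \<Rightarrow> real ^ 'm \<Rightarrow> real) \<Rightarrow> (real ^ 'm \<Rightarrow> (real ^ 'm) ^ 2) \<Rightarrow>
   (real ^ 'm \<Rightarrow> pt \<Rightarrow> real) \<Rightarrow> ('j \<Rightarrow> real ^ 'm \<Rightarrow> pt) \<Rightarrow> bool" where
  "weak_LF_splitting J g F speed \<zeta> \<longleftrightarrow>
     (\<forall>u\<in>inv_dom J g. \<forall>n. norm n = 1 \<longrightarrow>
        0 \<le> speed u n \<and>
        (\<forall>j\<in>J. \<forall>us\<in>bdry_part J g j. \<forall>a\<ge>speed u n.
           a * ((u - us) \<bullet> grad (g j) us) + normal_flux F u n \<bullet> grad (g j) us \<ge> - (\<zeta> j us \<bullet> n) \<and>
           a * ((u - us) \<bullet> grad (g j) us) - normal_flux F u n \<bullet> grad (g j) us \<ge> \<zeta> j us \<bullet> n))"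

text \<open>The state seen from \<open>K\<close> across \<open>e\<close> at the \<open>\<nu>\<close>-th node; \<open>ub K e \<nu>\<close> is the prescribed
  exterior state on boundary edges.\<close>

definition outer_state ::
  "pt set \<Rightarrow> cell set \<Rightarrow> (edge \<Rightarrow> nat \<Rightarrow> pt) \<Rightarrow> (cell \<Rightarrow> pt \<Rightarrow> real ^ 'm) \<Rightarrow>
   (cell \<Rightarrow> edge \<Rightarrow> nat \<Rightarrow> real ^ 'm) \<Rightarrow> cell \<Rightarrow> edge \<Rightarrow> nat \<Rightarrow> real ^ 'm" where
  "outer_state \<Omega> T x uh ub K e \<nu> =
     (if boundary_edge \<Omega> e then ub K e \<nu> else uh (neighbour T K e) (x e \<nu>))"

definition LF_flux ::
  "(real ^ 'm \<Rightarrow> (real ^ 'm) ^ 2) \<Rightarrow> real \<Rightarrow> pt \<Rightarrow> real ^ 'm \<Rightarrow> real ^ 'm \<Rightarrow> real ^ 'm" where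
  "LF_flux F a n ui ue =
     (1/2) *\<^sub>R (normal_flux F ui n + normal_flux F ue n) - (a/2) *\<^sub>R (ue - ui)"

definition LF_update ::
  "pt set \<Rightarrow> cell set \<Rightarrow> nat \<Rightarrow> (edge \<Rightarrow> nat \<Rightarrow> pt) \<Rightarrow> (edge \<Rightarrow> nat \<Rightarrow> real) \<Rightarrow>
   (real ^ 'm \<Rightarrow> (real ^ 'm) ^ 2) \<Rightarrow> (cell \<Rightarrow> edge \<Rightarrow> nat \<Rightarrow> real) \<Rightarrow> real \<Rightarrow>
   (cell \<Rightarrow> real ^ 'm) \<Rightarrow> (cell \<Rightarrow> pt \<Rightarrow> real ^ 'm) \<Rightarrow> (cell \<Rightarrow> edge \<Rightarrow> nat \<Rightarrow> real ^ 'm) \<Rightarrow>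
   cell \<Rightarrow> real ^ 'm" where
  "LF_update \<Omega> T Nq x \<omega> F \<alpha> dt ubar uh ub K =
     ubar K - (dt / area K) *\<^sub>R
       (\<Sum>e\<in>edges K. edge_length e *\<^sub>R
          (\<Sum>\<nu>=1..Nq. \<omega> e \<nu> *\<^sub>R
             LF_flux F (\<alpha> K e \<nu>) (outward_normal K e)
               (uh K (x e \<nu>)) (outer_state \<Omega> T x uh ub K e \<nu>)))"

definition cell_speed ::
  "nat \<Rightarrow> (edge \<Rightarrow> nat \<Rightarrow> pt) \<Rightarrow> (real ^ 'm \<Rightarrow> pt \<Rightarrow> real) \<Rightarrow> (cell \<Rightarrow> pt \<Rightarrow> real ^ 'm) \<Rightarrow>
   cell \<Rightarrow> real" where
  "cell_speed Nq x speed uh K =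
     (MAX e\<in>edges K. MAX \<nu>\<in>{1..Nq}. speed (uh K (x e \<nu>)) (outward_normal K e))"

text \<open>In \<open>ereal\<close> a positive number divided by 0 is \<open>\<infinity>\<close>: cells in which all wave speeds vanish
  impose no restriction.\<close>

definition CFL ::
  "cell set \<Rightarrow> (cell \<Rightarrow> edge \<Rightarrow> real) \<Rightarrow> nat \<Rightarrow> (edge \<Rightarrow> nat \<Rightarrow> pt) \<Rightarrow>
   (real ^ 'm \<Rightarrow> pt \<Rightarrow> real) \<Rightarrow> (cell \<Rightarrow> pt \<Rightarrow> real ^ 'm) \<Rightarrow> real \<Rightarrow> bool" where
  "CFL T \<Lambda> Nq x speed uh dt \<longleftrightarrow>
     ereal dt \<le> (MIN K\<in>T. ereal (mu K (\<Lambda> K)) / ereal (2 * cell_speed Nq x speed uh K))"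

text \<open>\<open>CFL\<close> does not see the numerical viscosities \<open>\<alpha> K e \<nu>\<close>, which are bounded only from below and
  may exceed the interior wave speeds (through the outer states, or by choice). Without control of
  their size the scheme is not invariant: take \<open>F = 0\<close>, \<open>G = [0, 1]\<close>, data 0 in a cell and 1 around
  it, and \<open>\<alpha>\<close> large. The condition below follows from \<open>CFL\<close> whenever
  \<open>\<alpha> K e \<nu> \<le> 3 * cell_speed Nq x speed uh K\<close>; and both conditions follow from
  \<open>2 * dt * \<alpha> K e \<nu> \<le> mu K (\<Lambda> K)\<close>.\<close>

definition viscosity_CFL ::
  "cell set \<Rightarrow> (cell \<Rightarrow> edge \<Rightarrow> real) \<Rightarrow> nat \<Rightarrow> (cell \<Rightarrow> edge \<Rightarrow> nat \<Rightarrow> real) \<Rightarrow> real \<Rightarrow> bool" where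
  "viscosity_CFL T \<Lambda> Nq \<alpha> dt \<longleftrightarrow>
     (\<forall>K\<in>T. \<forall>e\<in>edges K. \<forall>\<nu>\<in>{1..Nq}. 2 * dt * \<alpha> K e \<nu> \<le> 3 * mu K (\<Lambda> K))"

end

theory Submission
  imports Defs
begin

text \<open>
  The set \<open>G\<close> is the intersection of the half-spaces \<open>(u - d) \<bullet> N \<ge> 0\<close>, where \<open>d\<close> runs
  through the boundary points at which some \<open>g\<^sub>j\<close> vanishes and \<open>N\<close> is the gradient of \<open>g\<^sub>j\<close> at \<open>d\<close>
  (\<open>inv_dom_supporting\<close>, \<open>in_inv_dom_if_supporting\<close>).
  Membership of the new average in \<open>G\<close> can therefore be tested for one pair \<open>(d, N)\<close> at a time, and
  each test is a scalar inequality that is linear in the states and in the flux.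

  For a fixed test, the old average is split into the node values on the edges, with weights
  \<open>\<Lambda> e * \<omega> e \<nu>\<close>, and one more state \<open>w\<close> of \<open>G\<close> with the remaining weight
  (\<open>limit_cell_average_split\<close>). The state \<open>w\<close> contributes a nonnegative amount. At a node, the numerical
  flux uses up the part \<open>c * \<alpha> / 2\<close> of the weight \<open>\<Lambda> e\<close> of the inner state,
  where \<open>c = dt * |e| / |K|\<close>; the time step is such that what is left is at least \<open>c / 2\<close> times the wave
  speed of this state. So the splitting inequality applies to the inner and to the outer state,
  each with the factor \<open>c / 2\<close>, and the node contributes at least \<open>c * (\<zeta> \<bullet> n)\<close>
  (\<open>LF_node_bound\<close>, \<open>node_time_step\<close>). The vector \<open>\<zeta>\<close> depends on the test only, not on the node, so the sum of
  these lower bounds is a multiple of \<open>\<zeta> \<bullet> (\<Sum>e. |e| n\<^sub>e)\<close>.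

  This vanishes because the boundary of a polygon is closed (\<open>sum_edge_normals_eq_0\<close>). A quarter turn takes
  \<open>|e| n\<^sub>e\<close> to the difference of the end points of \<open>e\<close> in counterclockwise order. Every vertex
  is the head of exactly one edge and the tail of exactly one edge, so the differences cancel.
\<close>

section \<open>The edge normals of a convex polygon\<close>

definition quarter_turn :: "pt \<Rightarrow> pt" where
  "quarter_turn x = vector [- (x $ 2), x $ 1]"

lemma quarter_turn_nth [simp]:
  "quarter_turn x $ 1 = - (x $ 2)" "quarter_turn x $ 2 = x $ 1"
  by (simp_all add: quarter_turn_def)

lemma linear_quarter_turn: "linear quarter_turn"
  by (rule linearI) (simp_all add: vec_eq_iff forall_2)

lemma inner_pt: "(x::pt) \<bullet> y = x $ 1 * y $ 1 + x $ 2 * y $ 2"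
  by (simp add: inner_vec_def UNIV_2)

lemma inner_quarter_turn: "x \<bullet> quarter_turn y = - (y \<bullet> quarter_turn x)"
  by (simp add: inner_pt algebra_simps)

lemma norm_quarter_turn [simp]: "norm (quarter_turn x) = norm x"
  by (simp add: norm_eq_sqrt_inner inner_pt)

lemma quarter_turn_eq_0_iff [simp]: "quarter_turn x = 0 \<longleftrightarrow> x = 0"
  by (metis norm_eq_zero norm_quarter_turn)

lemma unit_normal_expansion:
  assumes "norm n = 1"
  shows "x = (x \<bullet> n) *\<^sub>R n + (x \<bullet> quarter_turn n) *\<^sub>R quarter_turn n"
proof -
  have 1: "n $ 1 * n $ 1 + n $ 2 * n $ 2 = 1"
    using assms by (simp add: norm_eq_sqrt_inner inner_pt)
  have "x $ 1 = x $ 1 * (n $ 1 * n $ 1 + n $ 2 * n $ 2)" "x $ 2 = x $ 2 * (n $ 1 * n $ 1 + n $ 2 * n $ 2)"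
    by (simp_all add: 1)
  then show ?thesis
    by (simp add: vec_eq_iff forall_2 inner_pt algebra_simps)
qed

text \<open>Two parallel unit vectors agree up to sign, and opposite signs would confine the open set \<open>K\<close> to a
  line. This makes the outward normal of an edge well defined, and it also excludes two distinct
  collinear edges through one point.\<close>

lemma supporting_normal_unique:
  assumes K: "open K" "K \<noteq> {}" and unit: "norm m = 1" "norm n = 1"
    and parallel: "m \<bullet> quarter_turn n = 0"
    and supp: "\<And>x. x \<in> K \<Longrightarrow> m \<bullet> x \<le> m \<bullet> v" "\<And>x. x \<in> K \<Longrightarrow> n \<bullet> x \<le> n \<bullet> v"
  shows "m = n"
proof -
  have m: "m = (m \<bullet> n) *\<^sub>R n"
    using unit_normal_expansion[OF unit(2), of m] parallel by simp
  have "\<bar>m \<bullet> n\<bar> = 1"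
    using arg_cong[OF m, of norm] unit by simp
  moreover have "m \<bullet> n \<noteq> - 1"
  proof
    assume "m \<bullet> n = - 1"
    with m have "m = - n" by simp
    with supp have "K \<subseteq> {x. n \<bullet> x = n \<bullet> v}" by (force intro: antisym)
    then have "interior K \<subseteq> interior {x. n \<bullet> x = n \<bullet> v}" by (rule interior_mono)
    moreover have "n \<noteq> 0" using unit by auto
    ultimately show False using K by (simp add: interior_open)
  qed
  ultimately show ?thesis using m by (simp add: abs_if split: if_splits)
qed

lemma aff_dim_cell: "open K \<Longrightarrow> K \<noteq> {} \<Longrightarrow> aff_dim (closure K :: pt set) = 2"
  by (simp add: aff_dim_open)

lemma diameter_segment: "diameter (closed_segment a b) = dist a (b :: 'a :: euclidean_space)"
proof (rule antisym)
  have "norm (x - y) \<le> dist a b" if xy: "x \<in> closed_segment a b" "y \<in> closed_segment a b" for x y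
  proof -
    obtain s t where s: "x = (1 - s) *\<^sub>R a + s *\<^sub>R b" "0 \<le> s" "s \<le> 1"
      and t: "y = (1 - t) *\<^sub>R a + t *\<^sub>R b" "0 \<le> t" "t \<le> 1"
      using xy by (auto simp: in_segment)
    have "x - y = (s - t) *\<^sub>R (b - a)" unfolding s(1) t(1) by (simp add: algebra_simps)
    moreover have "\<bar>s - t\<bar> \<le> 1" using s t by auto
    ultimately show ?thesis
      by (simp add: dist_norm norm_minus_commute mult_left_le_one_le)
  qed
  then show "diameter (closed_segment a b) \<le> dist a b" by (intro diameter_le) auto
  show "dist a b \<le> diameter (closed_segment a b)"
    by (intro diameter_bounded_bound compact_imp_bounded compact_segment) auto
qed

text \<open>The last two conjuncts say that the line through \<open>e\<close> supports the cell and cuts out precisely \<open>e\<close>: faces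
  of polyhedra are exposed. The orientation from \<open>a\<close> to \<open>b\<close> has the cell on its left.\<close>

lemma oriented_edge_ex:
  assumes K: "open K" "K \<noteq> {}" "polytope (closure K)" and e: "e \<in> edges K"
  shows "\<exists>a b. a \<noteq> b \<and> e = closed_segment a b \<and>
    edge_length e *\<^sub>R quarter_turn (outward_normal K e) = b - a \<and>
    norm (outward_normal K e) = 1 \<and>
    (\<forall>x\<in>closure K. outward_normal K e \<bullet> x \<le> outward_normal K e \<bullet> a) \<and>
    e = closure K \<inter> {x. outward_normal K e \<bullet> x = outward_normal K e \<bullet> a}"
proof -
  have face: "e face_of closure K" and dim: "aff_dim e = 1"
    using e by (auto simp: edges_def edge_of_def)
  have poly: "polyhedron (closure K)"
    using K by (simp add: polytope_imp_polyhedron)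
  have "e exposed_face_of closure K"
    using exposed_face_of_polyhedron[OF poly] face by simp
  then obtain m c where le: "closure K \<subseteq> {x. m \<bullet> x \<le> c}" and eq: "e = closure K \<inter> {x. m \<bullet> x = c}"
    by (auto simp: exposed_face_of_def)
  have "m \<noteq> 0"
  proof
    assume "m = 0"
    then have "e = closure K \<or> e = {}" using eq by auto
    then show False using dim aff_dim_cell[OF K(1,2)] by auto
  qed
  define n where "n = m /\<^sub>R norm m"
  have unit: "norm n = 1" using \<open>m \<noteq> 0\<close> by (simp add: n_def)
  have nm: "n \<bullet> x = (m \<bullet> x) / norm m" for x by (simp add: n_def divide_inverse)
  have "polytope e" using face_of_polytope_polytope[OF K(3) face] .
  then have "compact e" "convex e" "collinear e" "e \<noteq> {}"
    using dim by (auto simp: polytope_imp_compact polytope_imp_convex collinear_aff_dim)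
  then obtain a0 b0 where seg0: "e = closed_segment a0 b0"
    by (metis compact_convex_collinear_segment)
  have "a0 \<noteq> b0" using dim seg0 by auto
  have on: "m \<bullet> y = c" if "y \<in> e" for y using that eq by auto
  have perp0: "n \<bullet> (b0 - a0) = 0"
    using on[of a0] on[of b0] seg0 by (simp add: nm inner_diff_right)
  define t where "t = (b0 - a0) \<bullet> quarter_turn n"
  have d0: "b0 - a0 = t *\<^sub>R quarter_turn n"
    using unit_normal_expansion[OF unit, of "b0 - a0"] perp0 by (simp add: t_def inner_commute)
  \<comment> \<open>The segment comes without an orientation; the sign of \<open>t\<close> tells which end is the tail.\<close>
  define a b where "a = (if t \<ge> 0 then a0 else b0)" and "b = (if t \<ge> 0 then b0 else a0)"
  have seg: "e = closed_segment a b"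
    using seg0 by (auto simp: a_def b_def closed_segment_commute)
  have ab: "a \<noteq> b" using \<open>a0 \<noteq> b0\<close> by (auto simp: a_def b_def)
  have "b - a = \<bar>t\<bar> *\<^sub>R quarter_turn n"
    using d0 by (auto simp: a_def b_def abs_if) (metis minus_diff_eq)
  moreover from this have "norm (b - a) = \<bar>t\<bar>" using unit by simp
  ultimately have d: "b - a = norm (b - a) *\<^sub>R quarter_turn n" by simp
  have len: "edge_length e = norm (b - a)"
    by (simp add: edge_length_def seg diameter_segment dist_norm norm_minus_commute)
  have mc: "m \<bullet> a = c" using on seg by simp
  have le': "n \<bullet> x \<le> n \<bullet> a" if "x \<in> closure K" for x
    using le that mc by (auto simp: nm divide_right_mono)
  have eq': "e = closure K \<inter> {x. n \<bullet> x = n \<bullet> a}"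
    using eq mc \<open>m \<noteq> 0\<close> by (auto simp: nm)
  have normal: "outward_normal K e = n"
    unfolding outward_normal_def
  proof (rule the_equality)
    show "norm n = 1 \<and> (\<exists>c. (\<forall>x\<in>e. n \<bullet> x = c) \<and> (\<forall>x\<in>K. n \<bullet> x \<le> c))"
      using unit le' eq' closure_subset by blast
  next
    fix n' assume n': "norm n' = 1 \<and> (\<exists>c. (\<forall>x\<in>e. n' \<bullet> x = c) \<and> (\<forall>x\<in>K. n' \<bullet> x \<le> c))"
    then obtain c' where c': "\<And>x. x \<in> e \<Longrightarrow> n' \<bullet> x = c'" "\<And>x. x \<in> K \<Longrightarrow> n' \<bullet> x \<le> c'" by auto
    have "n' \<bullet> (b - a) = 0" using c'(1)[of a] c'(1)[of b] seg by (simp add: inner_diff_right)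
    then have "norm (b - a) * (n' \<bullet> quarter_turn n) = 0" by (metis d inner_scaleR_right)
    then have "n' \<bullet> quarter_turn n = 0" using ab by simp
    then show "n' = n"
      using supporting_normal_unique[OF K(1,2), of n' n a] n' unit c' seg le' closure_subset
      by (metis ends_in_segment(1) subsetD)
  qed
  show ?thesis
    unfolding normal len using ab seg d le' eq' unit by metis
qed

lemma edge_length_pos:
  assumes K: "open K" "K \<noteq> {}" "polytope (closure K)" and e: "e \<in> edges K"
  shows "0 < edge_length e"
proof -
  obtain a b where "a \<noteq> b" "e = closed_segment a b"
    using oriented_edge_ex[OF K e] by blast
  then show ?thesis by (simp add: edge_length_def diameter_segment)
qed

lemma norm_outward_normal:
  assumes K: "open K" "K \<noteq> {}" "polytope (closure K)" and e: "e \<in> edges K"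
  shows "norm (outward_normal K e) = 1"
  using oriented_edge_ex[OF K e] by blast

text \<open>A proper face of a polyhedron is the intersection of the facets that contain it. In the plane the
  facets are the edges, and neither no edge nor a single one has a point as intersection.\<close>

lemma vertex_in_two_edges:
  assumes K: "open K" "K \<noteq> {}" "polytope (closure K)" and v: "v extreme_point_of closure K"
  shows "\<exists>e1\<in>edges K. \<exists>e2\<in>edges K. e1 \<noteq> e2 \<and> v \<in> e1 \<and> v \<in> e2"
proof (rule ccontr)
  assume neg: "\<not> ?thesis"
  have dim: "aff_dim (closure K) = 2" by (rule aff_dim_cell[OF K(1,2)])
  have facets: "h facet_of closure K \<longleftrightarrow> h \<in> edges K" for h
    using dim by (auto simp: facet_of_def edges_def edge_of_def)
  have "{v} face_of closure K" using v by (simp add: face_of_singleton)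
  moreover have "{v} \<noteq> closure K" using dim by (metis aff_dim_sing zero_neq_numeral)
  ultimately have inter: "{v} = \<Inter>{h. h \<in> edges K \<and> v \<in> h}"
    using face_of_polyhedron[OF polytope_imp_polyhedron[OF K(3)], of "{v}"] by (simp add: facets)
  show False
  proof (cases "\<exists>e\<in>edges K. v \<in> e")
    case True
    then obtain e where "e \<in> edges K" "v \<in> e" by blast
    with neg have "{h. h \<in> edges K \<and> v \<in> h} = {e}" by blast
    with inter have "{v} = e" by simp
    with \<open>e \<in> edges K\<close> show False by (auto simp: edges_def edge_of_def)
  next
    case False
    then have "{h. h \<in> edges K \<and> v \<in> h} = {}" by blast
    with inter have "{v} = UNIV" by simp
    then have "v + axis 1 1 = v" by blast
    then show False by simp
  qed
qed

text \<open>Tails \<open>a e\<close> and heads \<open>b e\<close> are chosen for all edges. If two edges had the same head, the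
  quantity \<open>n \<bullet> quarter_turn n'\<close> of their normals, which changes sign when the edges are exchanged, would be
  nonnegative in either order, as each tail lies behind the line of the other edge. The normals would then be
  parallel and the edges equal. The same holds for tails. Of the two edges at a vertex one
  therefore arrives and the other leaves, and both \<open>a\<close> and \<open>b\<close> map the edges bijectively
  to the vertices.\<close>

lemma sum_edge_normals_eq_0:
  assumes K: "open K" "K \<noteq> {}" "polytope (closure K)"
  shows "(\<Sum>e\<in>edges K. edge_length e *\<^sub>R outward_normal K e) = 0"
proof -
  let ?n = "outward_normal K"
  obtain a b where ab:
    "\<And>e. e \<in> edges K \<Longrightarrow> a e \<noteq> b e \<and> e = closed_segment (a e) (b e) \<and>
      edge_length e *\<^sub>R quarter_turn (?n e) = b e - a e \<and> norm (?n e) = 1 \<and>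
      (\<forall>x\<in>closure K. ?n e \<bullet> x \<le> ?n e \<bullet> a e) \<and>
      e = closure K \<inter> {x. ?n e \<bullet> x = ?n e \<bullet> a e}"
    using oriented_edge_ex[OF K] by metis
  have len: "edge_length e > 0" if "e \<in> edges K" for e
    using edge_length_pos[OF K that] .
  have on: "?n e \<bullet> x = ?n e \<bullet> a e" if "e \<in> edges K" "x \<in> e" for e x
    using ab[OF that(1)] that(2) by blast
  have le: "?n e \<bullet> x \<le> ?n e \<bullet> v" if "e \<in> edges K" "v \<in> e" "x \<in> closure K" for e v x
    using ab[OF that(1)] on[OF that(1,2)] that(3) by metis
  have ends: "a e \<in> e" "b e \<in> e" "e \<subseteq> closure K" if "e \<in> edges K" for e
    using ab[OF that] by (metis ends_in_segment, metis ends_in_segment, blast)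
  have same: "e = e'" if e: "e \<in> edges K" "e' \<in> edges K" "v \<in> e" "v \<in> e'"
    and par: "?n e \<bullet> quarter_turn (?n e') = 0" for e e' v
  proof -
    have "?n e = ?n e'"
      using supporting_normal_unique[OF K(1,2), of "?n e" "?n e'" v] ab e par le closure_subset by blast
    then show ?thesis
      using ab[OF e(1)] ab[OF e(2)] on[OF e(1,3)] on[OF e(2,4)] by metis
  qed
  have turn: "?n e' \<bullet> (b e - a e) = edge_length e * (?n e' \<bullet> quarter_turn (?n e))" if "e \<in> edges K" for e e'
    using ab[OF that] by (metis inner_scaleR_right)
  have inj_b: "e = e'" if e: "e \<in> edges K" "e' \<in> edges K" and v: "b e = b e'" for e e'
  proof -
    have "?n e' \<bullet> (b e - a e) \<ge> 0" "?n e \<bullet> (b e' - a e') \<ge> 0"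
      using le[OF e(2), of "b e'" "a e"] le[OF e(1), of "b e" "a e'"]
        subsetD[OF ends(3) ends(1)] ends(2)[OF e(1)] ends(2)[OF e(2)] e v
      by (simp_all add: inner_diff_right)
    then have "?n e' \<bullet> quarter_turn (?n e) \<ge> 0" "?n e \<bullet> quarter_turn (?n e') \<ge> 0"
      using turn e len[OF e(1)] len[OF e(2)] by (auto simp: zero_le_mult_iff)
    then have "?n e \<bullet> quarter_turn (?n e') = 0"
      using inner_quarter_turn[of "?n e" "?n e'"] by simp
    with same[OF e, of "b e"] ends e v show ?thesis by metis
  qed
  have inj_a: "e = e'" if e: "e \<in> edges K" "e' \<in> edges K" and v: "a e = a e'" for e e'
  proof -
    have "?n e' \<bullet> (b e - a e) \<le> 0" "?n e \<bullet> (b e' - a e') \<le> 0"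
      using le[OF e(2), of "a e'" "b e"] le[OF e(1), of "a e" "b e'"]
        subsetD[OF ends(3) ends(2)] ends(1)[OF e(1)] ends(1)[OF e(2)] e v
      by (simp_all add: inner_diff_right)
    then have "?n e' \<bullet> quarter_turn (?n e) \<le> 0" "?n e \<bullet> quarter_turn (?n e') \<le> 0"
      using turn e len[OF e(1)] len[OF e(2)] by (auto simp: mult_le_0_iff)
    then have "?n e \<bullet> quarter_turn (?n e') = 0"
      using inner_quarter_turn[of "?n e" "?n e'"] by simp
    with same[OF e, of "a e"] ends e v show ?thesis by metis
  qed
  let ?V = "{v. v extreme_point_of closure K}"
  have ext: "v extreme_point_of closure K \<longleftrightarrow> v = a e \<or> v = b e" if "e \<in> edges K" "v \<in> e" for e v
  proof -
    have "e face_of closure K" using that by (simp add: edges_def edge_of_def)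
    then have "v extreme_point_of closure K \<longleftrightarrow> v extreme_point_of e"
      using that by (simp add: extreme_point_of_face)
    also have "\<dots> \<longleftrightarrow> v extreme_point_of closed_segment (a e) (b e)"
      using ab[OF that(1)] by metis
    finally show ?thesis by (simp add: extreme_point_of_segment)
  qed
  have both: "v \<in> a ` edges K \<and> v \<in> b ` edges K" if v: "v \<in> ?V" for v
  proof -
    obtain e1 e2 where e: "e1 \<in> edges K" "e2 \<in> edges K" "e1 \<noteq> e2" "v \<in> e1" "v \<in> e2"
      using vertex_in_two_edges[OF K, of v] v by auto
    then have "v = a e1 \<or> v = b e1" "v = a e2 \<or> v = b e2" using ext that by auto
    then show ?thesis using e inj_a inj_b by (metis imageI)
  qed
  have im: "a ` edges K = ?V" "b ` edges K = ?V"
    using both ext ends by blast+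
  have "quarter_turn (\<Sum>e\<in>edges K. edge_length e *\<^sub>R ?n e) =
      (\<Sum>e\<in>edges K. edge_length e *\<^sub>R quarter_turn (?n e))"
    by (simp add: linear_sum[OF linear_quarter_turn] linear_scale[OF linear_quarter_turn])
  also have "\<dots> = (\<Sum>e\<in>edges K. b e) - (\<Sum>e\<in>edges K. a e)"
    using ab by (simp add: sum_subtractf)
  also have "(\<Sum>e\<in>edges K. b e) = \<Sum>?V"
    unfolding im(2)[symmetric] using inj_b by (simp add: sum.reindex inj_on_def)
  also have "(\<Sum>e\<in>edges K. a e) = \<Sum>?V"
    unfolding im(1)[symmetric] using inj_a by (simp add: sum.reindex inj_on_def)
  finally show ?thesis by simp
qed

section \<open>The invariant domain as an intersection of half-spaces\<close>

text \<open>The chord slopes of a concave function decrease along a ray, so they are at most their limit at the base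
  point, which is the directional derivative there.\<close>

lemma concave_on_le_gradient:
  assumes conc: "concave_on U f" and U: "a \<in> U" "y \<in> U" and grad: "GDERIV f a :> d"
  shows "f y \<le> f a + (y - a) \<bullet> d"
proof -
  let ?h = "\<lambda>t::real. f (a + t *\<^sub>R (y - a))"
  have cvx: "convex_on U (\<lambda>x. - f x)" using conc by (simp add: concave_on_def)
  have slope: "f y - f a \<le> (?h t - ?h 0) / t" if "0 < t" "t \<le> 1" for t
  proof -
    have "(1 - t) * f a + t * f y \<le> f ((1 - t) *\<^sub>R a + t *\<^sub>R y)"
      using convex_onD[OF cvx, of t a y] that U by (simp add: algebra_simps)
    moreover have "(1 - t) *\<^sub>R a + t *\<^sub>R y = a + t *\<^sub>R (y - a)" by (simp add: algebra_simps)
    ultimately have "t * (f y - f a) \<le> ?h t - ?h 0" by (simp add: algebra_simps)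
    then show ?thesis using that by (simp add: pos_le_divide_eq mult.commute)
  qed
  have "(f has_derivative (\<lambda>h. h \<bullet> d)) (at (a + 0 *\<^sub>R (y - a)))"
    using grad by (simp add: gderiv_def)
  then have "(?h has_derivative (\<lambda>t. (t *\<^sub>R (y - a)) \<bullet> d)) (at 0)"
    by (rule has_derivative_compose[rotated]) (auto intro!: derivative_eq_intros)
  then have "(?h has_field_derivative (y - a) \<bullet> d) (at 0)"
    by (simp add: has_field_derivative_def mult_commute_abs)
  then have "((\<lambda>t. (?h t - ?h 0) / t) \<longlongrightarrow> (y - a) \<bullet> d) (at_right 0)"
    by (auto simp: has_field_derivative_iff intro: filterlim_mono[OF _ order_refl at_le])
  moreover have "\<forall>\<^sub>F t in at_right 0. f y - f a \<le> (?h t - ?h 0) / t"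
    unfolding eventually_at_right_field using slope by (intro exI[of _ 1]) auto
  ultimately have "f y - f a \<le> (y - a) \<bullet> d"
    by (intro tendsto_lowerbound) auto
  then show ?thesis by simp
qed

lemma GDERIV_isCont:
  "GDERIV f a :> d \<Longrightarrow> isCont f a"
  unfolding gderiv_def by (rule has_derivative_continuous)

lemma invariant_domain_concave:
  assumes "invariant_domain J g" "j \<in> J" "a \<in> inv_dom J g"
  obtains U where "open U" "inv_dom J g \<subseteq> U" "concave_on U (g j)" "GDERIV (g j) a :> grad (g j) a"
proof -
  obtain U where "open U" "inv_dom J g \<subseteq> U" "concave_on U (g j)" "C1_on U (g j)"
    using assms(1,2) unfolding invariant_domain_def by blast
  then show ?thesis using assms(3) that unfolding C1_on_def by blast
qed

lemma closed_invariant_domain: "invariant_domain J g \<Longrightarrow> closed (inv_dom J g)"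
  unfolding invariant_domain_def using closed_closure[of "{u. \<forall>j\<in>J. 0 < g j u}"] by simp

text \<open>By continuity a point with \<open>g\<^sub>j > 0\<close> is interior to \<open>{g\<^sub>j \<ge> 0}\<close>.\<close>

lemma bdry_part_zero:
  assumes dom: "invariant_domain J g" and j: "j \<in> J" and a: "a \<in> bdry_part J g j"
  shows "a \<in> inv_dom J g" and "g j a = 0"
proof -
  show G: "a \<in> inv_dom J g"
    using a closed_invariant_domain[OF dom] frontier_subset_closed by (auto simp: bdry_part_def)
  have cont: "isCont (g j) a"
    using invariant_domain_concave[OF dom j G] GDERIV_isCont by metis
  have "\<not> 0 < g j a"
  proof
    assume "0 < g j a"
    then have "\<forall>\<^sub>F y in nhds a. 0 < g j y"
      using cont by (intro order_tendstoD(1)) (auto simp: isCont_def tendsto_at_iff_tendsto_nhds)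
    then have "a \<in> interior {u. 0 \<le> g j u}"
      unfolding eventually_nhds interior_def by fastforce
    then show False using a by (simp add: bdry_part_def frontier_def)
  qed
  then show "g j a = 0" using G j by (auto simp: inv_dom_def)
qed

lemma inv_dom_supporting:
  assumes dom: "invariant_domain J g" and j: "j \<in> J" and a: "a \<in> bdry_part J g j"
    and y: "y \<in> inv_dom J g"
  shows "0 \<le> (y - a) \<bullet> grad (g j) a"
proof -
  note a' = bdry_part_zero[OF dom j a]
  obtain U where "open U" "inv_dom J g \<subseteq> U" "concave_on U (g j)" "GDERIV (g j) a :> grad (g j) a"
    using invariant_domain_concave[OF dom j a'(1)] .
  then have "g j y \<le> g j a + (y - a) \<bullet> grad (g j) a"
    using a' y by (intro concave_on_le_gradient[of U]) auto
  moreover have "0 \<le> g j y" using y j by (simp add: inv_dom_def)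
  ultimately show ?thesis using a'(2) by simp
qed

text \<open>From a point \<open>y\<close> outside \<open>G\<close> one walks to a point \<open>v\<close> at which all constraints are strict. At the
  frontier point \<open>a\<close> met on the way some \<open>g\<^sub>j\<close> vanishes. By concavity its gradient there has a
  positive product with \<open>v - a\<close>, hence a negative one with \<open>y - a\<close>, which points the opposite way.\<close>

lemma in_inv_dom_if_supporting:
  assumes dom: "invariant_domain J g" and ne: "inv_dom J g \<noteq> {}"
    and supp: "\<And>j a. j \<in> J \<Longrightarrow> a \<in> bdry_part J g j \<Longrightarrow> 0 \<le> (y - a) \<bullet> grad (g j) a"
  shows "y \<in> inv_dom J g"
proof (rule ccontr)
  assume y: "y \<notin> inv_dom J g"
  let ?G = "inv_dom J g"
  have fin: "finite J" and cl: "?G = closure {u. \<forall>j\<in>J. 0 < g j u}"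
    using dom by (auto simp: invariant_domain_def)
  have "{u. \<forall>j\<in>J. 0 < g j u} \<noteq> {}" using ne cl by (metis closure_empty)
  then obtain v where v: "\<And>j. j \<in> J \<Longrightarrow> 0 < g j v" by blast
  then have vG: "v \<in> ?G" by (force simp: inv_dom_def)
  obtain a where a: "a \<in> closed_segment v y" "a \<in> frontier ?G"
    using connected_Int_frontier[of "closed_segment v y" ?G] vG y by auto
  have aG: "a \<in> ?G" using a closed_invariant_domain[OF dom] frontier_subset_closed by blast
  \<comment> \<open>As \<open>J\<close> is finite, strict inequalities at \<open>a\<close> would persist in a common neighbourhood.\<close>
  have "\<exists>j\<in>J. g j a = 0"
  proof (rule ccontr)
    assume "\<not> ?thesis"
    then have pos: "0 < g j a" if "j \<in> J" for j using aG that by (force simp: inv_dom_def)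
    have "\<forall>\<^sub>F z in nhds a. 0 < g j z" if j: "j \<in> J" for j
    proof -
      have "isCont (g j) a" using invariant_domain_concave[OF dom j aG] GDERIV_isCont by metis
      then show ?thesis using pos[OF j]
        by (intro order_tendstoD(1)) (auto simp: isCont_def tendsto_at_iff_tendsto_nhds)
    qed
    then have "\<forall>\<^sub>F z in nhds a. \<forall>j\<in>J. 0 < g j z" using fin by (simp add: eventually_ball_finite)
    then have "a \<in> interior ?G"
      unfolding eventually_nhds interior_def inv_dom_def by fastforce
    then show False using a(2) by (simp add: frontier_def)
  qed
  then obtain j where j: "j \<in> J" and zero: "g j a = 0" by blast
  obtain U where U: "open U" "?G \<subseteq> U" "concave_on U (g j)" "GDERIV (g j) a :> grad (g j) a"
    using invariant_domain_concave[OF dom j aG] .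
  let ?n = "grad (g j) a"
  have upper: "g j z \<le> (z - a) \<bullet> ?n" if "z \<in> U" for z
    using concave_on_le_gradient[OF U(3) _ that U(4)] aG U(2) zero by auto
  have vn: "0 < (v - a) \<bullet> ?n" using upper[of v] v[OF j] vG U(2) by auto
  obtain s where s: "a = (1 - s) *\<^sub>R v + s *\<^sub>R y" "0 \<le> s" "s \<le> 1"
    using a(1) by (auto simp: in_segment)
  have "s \<noteq> 1" using s y aG by auto
  have sy: "s *\<^sub>R (y - a) = - ((1 - s) *\<^sub>R (v - a))"
    using s(1) by (simp add: algebra_simps)
  have "s * ((y - a) \<bullet> ?n) = - ((1 - s) * ((v - a) \<bullet> ?n))"
    using arg_cong[OF sy, of "\<lambda>w. w \<bullet> ?n"] by (simp only: inner_scaleR_left inner_minus_left)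
  also have "\<dots> < 0" using vn s \<open>s \<noteq> 1\<close> by simp
  finally have neg: "(y - a) \<bullet> ?n < 0" using s(2) by (simp add: mult_less_0_iff)
  \<comment> \<open>A short step from \<open>a\<close> towards \<open>y\<close> makes \<open>g\<^sub>j\<close> negative; it must stay in \<open>U\<close>, where \<open>g\<^sub>j\<close> is concave.\<close>
  have "a \<notin> interior {u. 0 \<le> g j u}"
  proof
    assume "a \<in> interior {u. 0 \<le> g j u}"
    then have "a \<in> interior {u. 0 \<le> g j u} \<inter> U" using aG U by auto
    moreover have "open (interior {u. 0 \<le> g j u} \<inter> U)" using U by blast
    ultimately obtain r where r: "r > 0" "ball a r \<subseteq> interior {u. 0 \<le> g j u} \<inter> U"
      by (meson openE)
    have "y \<noteq> a" using y aG by auto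
    define z where "z = a + (r / 2 / norm (y - a)) *\<^sub>R (y - a)"
    have "z \<in> ball a r" using r \<open>y \<noteq> a\<close> by (simp add: z_def dist_norm)
    then have "z \<in> U" "0 \<le> g j z" using r interior_subset by blast+
    moreover have "(z - a) \<bullet> ?n < 0"
      using neg r \<open>y \<noteq> a\<close> by (simp add: z_def mult_less_0_iff divide_less_0_iff)
    ultimately show False using upper[of z] by linarith
  qed
  moreover have "a \<in> {u. 0 \<le> g j u}" using aG j by (simp add: inv_dom_def)
  ultimately have "a \<in> bdry_part J g j"
    using a(2) closure_subset[of "{u. 0 \<le> g j u}"] by (auto simp: bdry_part_def frontier_def)
  with supp[OF j] neg show False by force
qed

section \<open>The cell average and the time step\<close>

lemma finite_edges: "polytope (closure K) \<Longrightarrow> finite (edges K)"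
  unfolding edges_def edge_of_def
  by (rule finite_subset[OF _ finite_polytope_faces[of "closure K"]]) auto

lemma area_pos:
  assumes "open K" "K \<noteq> {}" "polytope (closure K)"
  shows "0 < area K"
proof -
  have "bounded K"
    using polytope_imp_compact[OF assms(3)] compact_imp_bounded bounded_subset closure_subset by blast
  then have "K \<in> lmeasurable" using assms(1) by (rule lmeasurable_open)
  then have "measure lebesgue K \<noteq> 0"
    using open_not_negligible[OF assms(1,2)] negligible_iff_measure0 by blast
  then show ?thesis by (simp add: area_def order_less_le)
qed

text \<open>If the \<open>\<Lambda> e\<close> sum up to less than 1, then \<open>w\<close> is the interior value, which is built to satisfy the
  identity. If they sum up to 1, the scaling of \<open>u\<close> towards \<open>ubar\<close> preserves the identity
  \<open>total\<close>, whatever \<open>\<theta>\<close> is, and \<open>w\<close> has weight 0. In that case any node value serves as \<open>w\<close>;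
  that \<open>G\<close> is nonempty is needed to describe it by half-spaces.\<close>

lemma limit_cell_average_split:
  assumes quad: "\<And>e. e \<in> edges K \<Longrightarrow> edge_quadrature Nq x \<omega> W e"
    and cad: "cell_avg_decomp K V \<Lambda> S \<beta> xs"
    and u: "u \<in> W"
    and total: "(\<Sum>e\<in>edges K. \<Lambda> e) = 1 \<Longrightarrow> ubar = (\<Sum>e\<in>edges K. \<Lambda> e *\<^sub>R edge_avg e u)"
    and uh: "uh = limit \<theta> ubar u"
    and adm: "admissible G Nq x \<omega> K \<Lambda> ubar uh"
  obtains w where "w \<in> G"
    and "ubar = (\<Sum>e\<in>edges K. \<Lambda> e *\<^sub>R (\<Sum>\<nu>=1..Nq. \<omega> e \<nu> *\<^sub>R uh (x e \<nu>))) +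
           (1 - (\<Sum>e\<in>edges K. \<Lambda> e)) *\<^sub>R w"
    and "(\<Sum>e\<in>edges K. \<Lambda> e) \<le> 1"
proof -
  let ?s = "\<Sum>e\<in>edges K. \<Lambda> e"
  let ?A = "\<lambda>f. \<Sum>e\<in>edges K. \<Lambda> e *\<^sub>R (\<Sum>\<nu>=1..Nq. \<omega> e \<nu> *\<^sub>R f (x e \<nu>))"
  have le: "?s \<le> 1"
  proof -
    have "0 \<le> sum \<beta> {1..S}" using cad by (intro sum_nonneg) (auto simp: cell_avg_decomp_def less_imp_le)
    then show ?thesis using cad by (simp add: cell_avg_decomp_def)
  qed
  show ?thesis
  proof (cases "?s < 1")
    case True
    let ?w = "interior_value K \<Lambda> ubar (\<lambda>e. \<Sum>\<nu>=1..Nq. \<omega> e \<nu> *\<^sub>R uh (x e \<nu>))"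
    have "(1 - ?s) *\<^sub>R ?w = ubar - ?A uh" using True by (simp add: interior_value_def)
    moreover have "?w \<in> G" using adm True by (simp add: admissible_def)
    ultimately show ?thesis using that[of ?w] le by simp
  next
    case False
    then have s: "?s = 1" using le by simp
    then obtain e where e: "e \<in> edges K" by (metis sum.empty zero_neq_one ex_in_conv)
    have "(\<Sum>\<nu>=1..Nq. \<omega> e \<nu>) = 1" using quad[OF e] by (simp add: edge_quadrature_def)
    then have "Nq \<noteq> 0" by (intro notI) simp
    then have G: "uh (x e 1) \<in> G" using adm e by (simp add: admissible_def)
    have edge: "(\<Sum>\<nu>=1..Nq. \<omega> e \<nu> *\<^sub>R uh (x e \<nu>)) = (1 - \<theta>) *\<^sub>R ubar + \<theta> *\<^sub>R edge_avg e u"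
      if e: "e \<in> edges K" for e
    proof -
      have "(\<Sum>\<nu>=1..Nq. \<omega> e \<nu> *\<^sub>R uh (x e \<nu>)) =
          (\<Sum>\<nu>=1..Nq. \<omega> e \<nu> *\<^sub>R ((1 - \<theta>) *\<^sub>R ubar) + \<theta> *\<^sub>R (\<omega> e \<nu> *\<^sub>R u (x e \<nu>)))"
        by (intro sum.cong) (simp_all add: uh limit_def algebra_simps)
      also have "\<dots> = (\<Sum>\<nu>=1..Nq. \<omega> e \<nu>) *\<^sub>R ((1 - \<theta>) *\<^sub>R ubar) +
          \<theta> *\<^sub>R (\<Sum>\<nu>=1..Nq. \<omega> e \<nu> *\<^sub>R u (x e \<nu>))"
        by (simp only: sum.distrib scaleR_sum_left scaleR_sum_right)
      finally show ?thesis using quad[OF e] u by (simp add: edge_quadrature_def)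
    qed
    have "?A uh = (\<Sum>e\<in>edges K. \<Lambda> e *\<^sub>R ((1 - \<theta>) *\<^sub>R ubar) + \<theta> *\<^sub>R (\<Lambda> e *\<^sub>R edge_avg e u))"
      by (intro sum.cong) (simp_all only: edge scaleR_add_right scaleR_left_commute)
    also have "\<dots> = ?s *\<^sub>R ((1 - \<theta>) *\<^sub>R ubar) + \<theta> *\<^sub>R (\<Sum>e\<in>edges K. \<Lambda> e *\<^sub>R edge_avg e u)"
      by (simp only: sum.distrib scaleR_sum_left scaleR_sum_right)
    also have "\<dots> = ubar" using total[OF s] by (simp add: s algebra_simps)
    finally have "?A uh = ubar" .
    then show ?thesis using that[OF G] s by simp
  qed
qed

text \<open>The interior weights are positive, so they can only sum up to 0 if there are none.\<close>

lemma cell_avg_eq_edge_avgs: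
  assumes "cell_avg_decomp K W \<Lambda> S \<beta> xs" "u \<in> W" "(\<Sum>e\<in>edges K. \<Lambda> e) = 1"
  shows "cell_avg K u = (\<Sum>e\<in>edges K. \<Lambda> e *\<^sub>R edge_avg e u)"
proof -
  have pos: "\<And>s. s \<in> {1..S} \<Longrightarrow> 0 < \<beta> s" and "sum \<beta> {1..S} = 0"
    using assms by (auto simp: cell_avg_decomp_def)
  then have "{1..S} = {}" using sum_pos[of "{1..S}" \<beta>] by fastforce
  then show ?thesis using assms by (simp add: cell_avg_decomp_def)
qed

text \<open>By the first condition on the time step \<open>2 * dt * speed \<le> \<mu>\<close>, by the second
  \<open>2 * dt * \<alpha> \<le> 3 * \<mu>\<close>; the sum of the two is \<open>dt * (\<alpha> + speed) \<le> 2 * \<mu>\<close>.\<close>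

lemma node_time_step:
  assumes T: "finite T" "K \<in> T"
    and K: "open K" "K \<noteq> {}" "polytope (closure K)"
    and len: "\<And>e. e \<in> edges K \<Longrightarrow> 0 < edge_length e"
    and \<Lambda>: "\<And>e. e \<in> edges K \<Longrightarrow> 0 < \<Lambda> K e"
    and nonneg: "\<And>e \<nu>. e \<in> edges K \<Longrightarrow> \<nu> \<in> {1..Nq} \<Longrightarrow> 0 \<le> speed (uh K (x e \<nu>)) (outward_normal K e)"
    and dt: "0 < dt" "CFL T \<Lambda> Nq x speed uh dt" "viscosity_CFL T \<Lambda> Nq \<alpha> dt"
    and e: "e \<in> edges K" "\<nu> \<in> {1..Nq}"
  shows "dt * edge_length e / area K * (\<alpha> K e \<nu> + speed (uh K (x e \<nu>)) (outward_normal K e)) \<le> 2 * \<Lambda> K e"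
proof -
  let ?v = "\<lambda>e \<nu>. speed (uh K (x e \<nu>)) (outward_normal K e)"
  let ?s = "cell_speed Nq x speed uh K"
  let ?\<mu> = "mu K (\<Lambda> K)"
  have fin: "finite (edges K)" by (rule finite_edges[OF K(3)])
  have area: "0 < area K" by (rule area_pos[OF K])
  have mu_pos: "0 < ?\<mu>"
    unfolding mu_def using fin e(1) area len \<Lambda> by (subst Min_gr_iff) auto
  have mu_le: "?\<mu> \<le> \<Lambda> K e * area K / edge_length e"
    unfolding mu_def using fin e(1) by (intro Min_le) auto
  have "?v e \<nu> \<le> (MAX \<nu>\<in>{1..Nq}. ?v e \<nu>)" using e(2) by (intro Max_ge) auto
  also have "\<dots> \<le> ?s" unfolding cell_speed_def using fin e(1) by (intro Max_ge) auto
  finally have v_le: "?v e \<nu> \<le> ?s" .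
  then have s_nonneg: "0 \<le> ?s" using nonneg[OF e] by simp
  \<comment> \<open>If the cell speed is 0, the quotient in the condition is infinite and gives no bound on \<open>dt\<close>.\<close>
  have cfl: "2 * dt * ?s \<le> ?\<mu>"
  proof (cases "?s = 0")
    case False
    have "ereal dt \<le> ereal ?\<mu> / ereal (2 * ?s)"
      using dt(2) T unfolding CFL_def by (meson Min_le finite_imageI image_eqI order_trans)
    then have "dt \<le> ?\<mu> / (2 * ?s)" using False by simp
    then show ?thesis using False s_nonneg by (simp add: pos_le_divide_eq mult.commute mult.left_commute)
  qed (use mu_pos in simp)
  have visc: "2 * dt * \<alpha> K e \<nu> \<le> 3 * ?\<mu>"
    using dt(3) T(2) e by (simp add: viscosity_CFL_def)
  have "2 * dt * ?v e \<nu> \<le> 2 * dt * ?s" using v_le dt(1) by simp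
  then have "dt * (\<alpha> K e \<nu> + ?v e \<nu>) \<le> 2 * ?\<mu>"
    using cfl visc by (simp add: algebra_simps)
  also have "\<dots> \<le> 2 * (\<Lambda> K e * area K / edge_length e)" using mu_le by simp
  finally show ?thesis using len[OF e(1)] area by (simp add: field_simps)
qed

section \<open>One step of the scheme\<close>

text \<open>For one test \<open>(d, N)\<close>: \<open>Li\<close> and \<open>Le\<close> are the values of \<open>(u - d) \<bullet> N\<close> at the inner and the
  outer state, \<open>fi\<close> and \<open>fe\<close> the normal fluxes tested with \<open>N\<close>, \<open>z\<close> is \<open>\<zeta> \<bullet> n\<close>, \<open>a\<close> the numerical
  viscosity, \<open>s\<close> the wave speed of the inner state and \<open>r\<close> the weight of the edge.\<close>

lemma LF_node_bound:
  fixes c :: real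
  assumes c: "0 < c" "c * (a + s) \<le> 2 * r"
    and inner: "\<And>b. s \<le> b \<Longrightarrow> z \<le> b * Li - fi" and outer: "z \<le> a * Le - fe"
  shows "c * z \<le> r * Li - c * ((fi + fe) / 2 - a / 2 * (Le - Li))"
proof -
  \<comment> \<open>The inner state is left with the weight \<open>r - c * a / 2\<close>, which is \<open>c / 2\<close> times \<open>?b\<close>.\<close>
  let ?b = "2 * r / c - a"
  have "s \<le> ?b" using c by (simp add: field_simps)
  then have "z + z \<le> (?b * Li - fi) + (a * Le - fe)" using inner outer by (rule_tac add_mono) auto
  then have "c / 2 * (z + z) \<le> c / 2 * ((?b * Li - fi) + (a * Le - fe))"
    using c(1) by (intro mult_left_mono) auto
  also have "\<dots> = r * Li - c * ((fi + fe) / 2 - a / 2 * (Le - Li))"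
    using c(1) by (simp add: field_simps)
  finally show ?thesis by simp
qed

text \<open>The lower bounds for the nodes add up to 0 because \<open>z\<close> is the same vector at all of them and
  the edge normals balance.\<close>

lemma LF_update_supporting:
  fixes N d w :: "real ^ 'm"
  assumes closed_polygon: "(\<Sum>e\<in>edges K. edge_length e *\<^sub>R outward_normal K e) = 0"
    and weights: "\<And>e \<nu>. e \<in> edges K \<Longrightarrow> \<nu> \<in> {1..Nq} \<Longrightarrow> 0 \<le> \<omega> e \<nu>"
      "\<And>e. e \<in> edges K \<Longrightarrow> (\<Sum>\<nu>=1..Nq. \<omega> e \<nu>) = 1"
    and split: "ubar K = (\<Sum>e\<in>edges K. \<Lambda> e *\<^sub>R (\<Sum>\<nu>=1..Nq. \<omega> e \<nu> *\<^sub>R uh K (x e \<nu>))) +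
           (1 - (\<Sum>e\<in>edges K. \<Lambda> e)) *\<^sub>R w"
      "(\<Sum>e\<in>edges K. \<Lambda> e) \<le> 1" "0 \<le> (w - d) \<bullet> N"
    and node: "\<And>e \<nu>. e \<in> edges K \<Longrightarrow> \<nu> \<in> {1..Nq} \<Longrightarrow>
        dt * edge_length e / area K * (z \<bullet> outward_normal K e) \<le>
        \<Lambda> e * ((uh K (x e \<nu>) - d) \<bullet> N) - dt * edge_length e / area K *
          (LF_flux F (\<alpha> K e \<nu>) (outward_normal K e) (uh K (x e \<nu>))
             (outer_state \<Omega> T x uh ub K e \<nu>) \<bullet> N)"
  shows "0 \<le> (LF_update \<Omega> T Nq x \<omega> F \<alpha> dt ubar uh ub K - d) \<bullet> N"
proof -
  let ?s = "\<Sum>e\<in>edges K. \<Lambda> e"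
  let ?c = "\<lambda>e. dt * edge_length e / area K"
  let ?L = "\<lambda>e \<nu>. (uh K (x e \<nu>) - d) \<bullet> N"
  let ?f = "\<lambda>e \<nu>. LF_flux F (\<alpha> K e \<nu>) (outward_normal K e) (uh K (x e \<nu>))
             (outer_state \<Omega> T x uh ub K e \<nu>) \<bullet> N"
  have edge: "(\<Sum>\<nu>=1..Nq. \<omega> e \<nu> *\<^sub>R uh K (x e \<nu>)) \<bullet> N = (\<Sum>\<nu>=1..Nq. \<omega> e \<nu> * ?L e \<nu>) + d \<bullet> N"
    if "e \<in> edges K" for e
  proof -
    have "(\<Sum>\<nu>=1..Nq. \<omega> e \<nu> * ?L e \<nu>) =
        (\<Sum>\<nu>=1..Nq. \<omega> e \<nu> *\<^sub>R uh K (x e \<nu>)) \<bullet> N - (\<Sum>\<nu>=1..Nq. \<omega> e \<nu>) * (d \<bullet> N)"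
      by (simp add: inner_sum_left inner_diff_left right_diff_distrib sum_subtractf sum_distrib_right)
    then show ?thesis using weights(2)[OF that] by simp
  qed
  have "ubar K \<bullet> N = (\<Sum>e\<in>edges K. \<Lambda> e * ((\<Sum>\<nu>=1..Nq. \<omega> e \<nu> * ?L e \<nu>) + d \<bullet> N)) + (1 - ?s) * (w \<bullet> N)"
  proof -
    have "(\<Sum>e\<in>edges K. \<Lambda> e *\<^sub>R (\<Sum>\<nu>=1..Nq. \<omega> e \<nu> *\<^sub>R uh K (x e \<nu>))) \<bullet> N =
        (\<Sum>e\<in>edges K. \<Lambda> e * ((\<Sum>\<nu>=1..Nq. \<omega> e \<nu> * ?L e \<nu>) + d \<bullet> N))"
      by (rule trans[OF inner_sum_left], intro sum.cong) (simp_all only: inner_scaleR_left edge)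
    then show ?thesis by (simp only: split(1) inner_add_left inner_scaleR_left)
  qed
  also have "\<dots> = (\<Sum>e\<in>edges K. \<Sum>\<nu>=1..Nq. \<omega> e \<nu> * (\<Lambda> e * ?L e \<nu>)) + (1 - ?s) * ((w - d) \<bullet> N) + d \<bullet> N"
    by (simp add: inner_diff_left distrib_left right_diff_distrib left_diff_distrib sum.distrib
        sum_distrib_left sum_distrib_right mult.commute mult.left_commute)
  finally have avg: "(ubar K - d) \<bullet> N =
      (\<Sum>e\<in>edges K. \<Sum>\<nu>=1..Nq. \<omega> e \<nu> * (\<Lambda> e * ?L e \<nu>)) + (1 - ?s) * ((w - d) \<bullet> N)"
    by (simp add: inner_diff_left)
  have upd: "(LF_update \<Omega> T Nq x \<omega> F \<alpha> dt ubar uh ub K - d) \<bullet> N =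
      (ubar K - d) \<bullet> N - (\<Sum>e\<in>edges K. \<Sum>\<nu>=1..Nq. \<omega> e \<nu> * (?c e * ?f e \<nu>))"
    by (simp add: LF_update_def inner_diff_left inner_sum_left sum_distrib_left divide_inverse mult_ac)
  have "0 = dt / area K * (z \<bullet> (\<Sum>e\<in>edges K. edge_length e *\<^sub>R outward_normal K e))"
    by (simp add: closed_polygon)
  also have "\<dots> = (\<Sum>e\<in>edges K. 1 * (?c e * (z \<bullet> outward_normal K e)))"
    by (simp add: inner_sum_right sum_distrib_left mult_ac)
  also have "\<dots> = (\<Sum>e\<in>edges K. (\<Sum>\<nu>=1..Nq. \<omega> e \<nu>) * (?c e * (z \<bullet> outward_normal K e)))"
    by (intro sum.cong) (simp_all only: weights(2))
  also have "\<dots> = (\<Sum>e\<in>edges K. \<Sum>\<nu>=1..Nq. \<omega> e \<nu> * (?c e * (z \<bullet> outward_normal K e)))"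
    by (simp only: sum_distrib_right)
  also have "\<dots> \<le> (\<Sum>e\<in>edges K. \<Sum>\<nu>=1..Nq. \<omega> e \<nu> * (\<Lambda> e * ?L e \<nu> - ?c e * ?f e \<nu>))"
    using weights(1) node by (intro sum_mono mult_left_mono) auto
  also have "\<dots> = (\<Sum>e\<in>edges K. \<Sum>\<nu>=1..Nq. \<omega> e \<nu> * (\<Lambda> e * ?L e \<nu>)) -
      (\<Sum>e\<in>edges K. \<Sum>\<nu>=1..Nq. \<omega> e \<nu> * (?c e * ?f e \<nu>))"
    by (simp add: right_diff_distrib sum_subtractf)
  finally have "0 \<le> \<dots>" .
  moreover have "0 \<le> (1 - ?s) * ((w - d) \<bullet> N)" using split(2,3) by simp
  ultimately show ?thesis using upd avg by linarith
qed

theorem theorem2p9: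
  fixes \<Omega> :: "pt set" and T :: "cell set" and \<sigma> :: real and NE :: nat
    and F :: "real ^ 'm \<Rightarrow> (real ^ 'm) ^ 2"
    and J :: "'j set" and g :: "'j \<Rightarrow> real ^ 'm \<Rightarrow> real"
    and speed :: "real ^ 'm \<Rightarrow> pt \<Rightarrow> real" and \<zeta> :: "'j \<Rightarrow> real ^ 'm \<Rightarrow> pt"
    and k Nq :: nat and x :: "edge \<Rightarrow> nat \<Rightarrow> pt" and \<omega> :: "edge \<Rightarrow> nat \<Rightarrow> real"
    and W V :: "cell \<Rightarrow> (pt \<Rightarrow> real ^ 'm) set" and classic :: "cell \<Rightarrow> bool"
    and \<Lambda> :: "cell \<Rightarrow> edge \<Rightarrow> real" and S :: "cell \<Rightarrow> nat"
    and \<beta> :: "cell \<Rightarrow> nat \<Rightarrow> real" and xs :: "cell \<Rightarrow> nat \<Rightarrow> pt"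
    and u uh :: "cell \<Rightarrow> pt \<Rightarrow> real ^ 'm" and ubar :: "cell \<Rightarrow> real ^ 'm"
    and ub :: "cell \<Rightarrow> edge \<Rightarrow> nat \<Rightarrow> real ^ 'm"
    and \<alpha> :: "cell \<Rightarrow> edge \<Rightarrow> nat \<Rightarrow> real" and dt :: real
  defines "G \<equiv> inv_dom J g"
  assumes mesh: "conforming_mesh \<Omega> T" "shape_regular \<sigma> T" "\<forall>K\<in>T. card (edges K) \<le> NE"
    and domain: "invariant_domain J g"
    and splitting: "weak_LF_splitting J g F speed \<zeta>"
    and spaces: "\<forall>K\<in>T. finite_dim_space (W K) \<and> poly_space k \<subseteq> W K"
    and quadrature: "\<forall>K\<in>T. \<forall>e\<in>edges K. edge_quadrature Nq x \<omega> (W K) e"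
    and decomposition: "\<forall>K\<in>T. V K = (if classic K then W K else poly_space k) \<and>
        cell_avg_decomp K (V K) (\<Lambda> K) (S K) (\<beta> K) (xs K)"
    and reconstruction: "\<forall>K\<in>T. u K \<in> W K \<and> cell_avg K (u K) = ubar K"
    and no_interior_part: "\<forall>K\<in>T. \<not> classic K \<and> (\<Sum>e\<in>edges K. \<Lambda> K e) = 1 \<longrightarrow>
        ubar K = (\<Sum>e\<in>edges K. \<Lambda> K e *\<^sub>R edge_avg e (u K))"
    and limiter: "\<forall>K\<in>T. uh K =
        limit (if classic K then theta_classic G Nq x K (S K) (xs K) (ubar K) (u K)
               else theta_alternative G Nq x K (\<Lambda> K) (ubar K) (u K)) (ubar K) (u K)"
    and admissible: "\<forall>K\<in>T. admissible G Nq x \<omega> K (\<Lambda> K) (ubar K) (uh K)"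
    and viscosity: "\<forall>K\<in>T. \<forall>e\<in>edges K. \<forall>\<nu>\<in>{1..Nq}.
        \<alpha> K e \<nu> \<ge> max (speed (uh K (x e \<nu>)) (outward_normal K e))
                      (speed (outer_state \<Omega> T x uh ub K e \<nu>) (outward_normal K e))"
    and time_step: "0 < dt" "CFL T \<Lambda> Nq x speed uh dt" "viscosity_CFL T \<Lambda> Nq \<alpha> dt"
  shows "(\<forall>K\<in>T. (\<forall>e\<in>edges K. \<not> boundary_edge \<Omega> e) \<longrightarrow>
            LF_update \<Omega> T Nq x \<omega> F \<alpha> dt ubar uh ub K \<in> G) \<and>
         ((\<forall>K\<in>T. \<forall>e\<in>edges K. boundary_edge \<Omega> e \<longrightarrow> (\<forall>\<nu>\<in>{1..Nq}. ub K e \<nu> \<in> G)) \<longrightarrow>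
            (\<forall>K\<in>T. LF_update \<Omega> T Nq x \<omega> F \<alpha> dt ubar uh ub K \<in> G))"
proof -
  let ?n = outward_normal and ?uo = "outer_state \<Omega> T x uh ub"
  have cell: "open K" "K \<noteq> {}" "polytope (closure K)" if "K \<in> T" for K
    using mesh(1) that by (auto simp: conforming_mesh_def)
  have finT: "finite T" using mesh(1) by (simp add: conforming_mesh_def)
  have neighbours: "\<forall>K\<in>T. \<forall>e\<in>edges K. boundary_edge \<Omega> e \<or> (\<exists>!K'. is_neighbour T K e K')"
    using mesh(1) unfolding conforming_mesh_def by (elim conjE)
  have inner_G: "uh K (x e \<nu>) \<in> G" if "K \<in> T" "e \<in> edges K" "\<nu> \<in> {1..Nq}" for K e \<nu>
    using admissible that by (simp add: admissible_def)
  have neighbour_G: "?uo K e \<nu> \<in> G"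
    if K: "K \<in> T" "e \<in> edges K" "\<nu> \<in> {1..Nq}" and "\<not> boundary_edge \<Omega> e" for K e \<nu>
  proof -
    have "\<exists>!K'. is_neighbour T K e K'"
      using bspec[OF bspec[OF neighbours K(1)] K(2)] that(4) by argo
    then have "is_neighbour T K e (neighbour T K e)"
      unfolding neighbour_def by (rule theI')
    then show ?thesis
      using inner_G K(3) that(4) by (simp add: outer_state_def is_neighbour_def)
  qed
  have update_G: "LF_update \<Omega> T Nq x \<omega> F \<alpha> dt ubar uh ub K \<in> G"
    if K: "K \<in> T" and outer_G: "\<And>e \<nu>. e \<in> edges K \<Longrightarrow> \<nu> \<in> {1..Nq} \<Longrightarrow> ?uo K e \<nu> \<in> G" for K
  proof -
    note poly = cell[OF K]
    have quad: "\<And>e. e \<in> edges K \<Longrightarrow> edge_quadrature Nq x \<omega> (W K) e"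
      using quadrature K by blast
    have cad: "V K = (if classic K then W K else poly_space k)"
      "cell_avg_decomp K (V K) (\<Lambda> K) (S K) (\<beta> K) (xs K)"
      using decomposition K by auto
    have u: "u K \<in> W K" "cell_avg K (u K) = ubar K" using reconstruction K by auto
    have total: "ubar K = (\<Sum>e\<in>edges K. \<Lambda> K e *\<^sub>R edge_avg e (u K))" if "(\<Sum>e\<in>edges K. \<Lambda> K e) = 1"
    proof (cases "classic K")
      case True
      then show ?thesis using cell_avg_eq_edge_avgs[of K "W K"] cad u that by simp
    qed (use no_interior_part K that in blast)
    obtain w where w: "w \<in> G"
      "ubar K = (\<Sum>e\<in>edges K. \<Lambda> K e *\<^sub>R (\<Sum>\<nu>=1..Nq. \<omega> e \<nu> *\<^sub>R uh K (x e \<nu>))) +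
         (1 - (\<Sum>e\<in>edges K. \<Lambda> K e)) *\<^sub>R w"
      "(\<Sum>e\<in>edges K. \<Lambda> K e) \<le> 1"
      using limit_cell_average_split[OF quad cad(2) u(1) total
          bspec[OF limiter K] bspec[OF admissible K]] .
    show ?thesis
      unfolding G_def
    proof (rule in_inv_dom_if_supporting[OF domain])
      show "inv_dom J g \<noteq> {}" using w(1) by (auto simp: G_def)
    next
      fix j d assume j: "j \<in> J" and d: "d \<in> bdry_part J g j"
      let ?N = "grad (g j) d"
      have sp: "0 \<le> speed v n \<and> (\<forall>a\<ge>speed v n. \<zeta> j d \<bullet> n \<le> a * ((v - d) \<bullet> ?N) - normal_flux F v n \<bullet> ?N)"
        if "v \<in> G" "norm n = 1" for v n
        using splitting that j d by (simp add: weak_LF_splitting_def G_def)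
      show "0 \<le> (LF_update \<Omega> T Nq x \<omega> F \<alpha> dt ubar uh ub K - d) \<bullet> ?N"
      proof (rule LF_update_supporting[where z = "\<zeta> j d" and \<Lambda> = "\<Lambda> K" and \<omega> = \<omega> and x = x
            and uh = uh and ubar = ubar and K = K, OF sum_edge_normals_eq_0[OF poly] _ _ w(2,3)])
        show "0 \<le> \<omega> e \<nu>" if "e \<in> edges K" "\<nu> \<in> {1..Nq}" for e \<nu>
          using quad[OF that(1)] that(2) by (auto simp: edge_quadrature_def less_imp_le)
        show "(\<Sum>\<nu>=1..Nq. \<omega> e \<nu>) = 1" if "e \<in> edges K" for e
          using quad[OF that] by (simp add: edge_quadrature_def)
        show "0 \<le> (w - d) \<bullet> ?N"
          using inv_dom_supporting[OF domain j d] w(1) by (simp add: G_def)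
      next
        fix e \<nu> assume e: "e \<in> edges K" "\<nu> \<in> {1..Nq}"
        let ?ui = "uh K (x e \<nu>)" and ?c = "dt * edge_length e / area K"
        note unit = norm_outward_normal[OF poly e(1)]
        have "?c * (\<alpha> K e \<nu> + speed ?ui (?n K e)) \<le> 2 * \<Lambda> K e"
        proof (rule node_time_step[OF finT K poly _ _ _ time_step e])
          show "0 < edge_length e'" if "e' \<in> edges K" for e' using edge_length_pos[OF poly that] .
          show "0 < \<Lambda> K e'" if "e' \<in> edges K" for e' using cad(2) that by (simp add: cell_avg_decomp_def)
          show "0 \<le> speed (uh K (x e' \<nu>')) (?n K e')" if "e' \<in> edges K" "\<nu>' \<in> {1..Nq}" for e' \<nu>'
            using sp inner_G[OF K that] norm_outward_normal[OF poly that(1)] by blast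
        qed
        moreover have "0 < ?c" using time_step(1) area_pos[OF poly] edge_length_pos[OF poly e(1)] by simp
        moreover have "speed (?uo K e \<nu>) (?n K e) \<le> \<alpha> K e \<nu>" using viscosity K e by fastforce
        ultimately have "?c * (\<zeta> j d \<bullet> ?n K e) \<le> \<Lambda> K e * ((?ui - d) \<bullet> ?N) -
            ?c * ((normal_flux F ?ui (?n K e) \<bullet> ?N + normal_flux F (?uo K e \<nu>) (?n K e) \<bullet> ?N) / 2 -
              \<alpha> K e \<nu> / 2 * ((?uo K e \<nu> - d) \<bullet> ?N - (?ui - d) \<bullet> ?N))"
          using sp[OF inner_G[OF K e] unit] sp[OF outer_G[OF e] unit]
          by (intro LF_node_bound[where s = "speed ?ui (?n K e)"]) auto
        then show "?c * (\<zeta> j d \<bullet> ?n K e) \<le> \<Lambda> K e * ((?ui - d) \<bullet> ?N) -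
            ?c * (LF_flux F (\<alpha> K e \<nu>) (?n K e) ?ui (?uo K e \<nu>) \<bullet> ?N)"
          by (simp add: LF_flux_def inner_diff_left inner_add_left)
      qed
    qed
  qed
  show ?thesis
  proof (intro conjI ballI impI)
    fix K assume "K \<in> T" "\<forall>e\<in>edges K. \<not> boundary_edge \<Omega> e"
    then show "LF_update \<Omega> T Nq x \<omega> F \<alpha> dt ubar uh ub K \<in> G"
      using neighbour_G by (intro update_G) auto
  next
    fix K assume ub: "\<forall>K\<in>T. \<forall>e\<in>edges K. boundary_edge \<Omega> e \<longrightarrow> (\<forall>\<nu>\<in>{1..Nq}. ub K e \<nu> \<in> G)"
      and K: "K \<in> T"
    show "LF_update \<Omega> T Nq x \<omega> F \<alpha> dt ubar uh ub K \<in> G"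
    proof (rule update_G[OF K])
      fix e \<nu> assume e: "e \<in> edges K" "\<nu> \<in> {1..Nq}"
      show "?uo K e \<nu> \<in> G"
      proof (cases "boundary_edge \<Omega> e")
        case True
        then show ?thesis using ub K e by (simp add: outer_state_def)
      qed (use neighbour_G[OF K e] in simp)
    qed
  qed
qed

end
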